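(* In the setting described in the context, suppose the density $f$ satisfies the stated regularity conditions and the constraint function $\mathbf{h}$ satisfies the stated smoothness and rank conditions. If $\delta$ is a sufficiently small positive number (that is, there is $\delta_0\in(0,\alpha]$ such that for every $0<\delta<\delta_0$ the following holds), $0<\epsilon<1$, $n\ge n(\delta,\epsilon)$, and $\mathbf{x}\in\mathbf{X}_n$, where $\mathbf{X}_n$ is a set with properties (X1)-(X4) for $\delta,\epsilon$, then the system $$\tfrac1n \mathbf{s}(\mathbf{x},\boldsymbol{\phi})+\mathbf{J}_{\boldsymbol\omega}\boldsymbol\lambda=\mathbf{0},\qquad \mathbf{K}_{\boldsymbol\omega}\boldsymbol\lambda=\mathbf{0},\qquad \mathbf{h}(\boldsymbol\omega)=\mathbf{0}$$ in the unknowns $\boldsymbol\omega=(\boldsymbol\phi,\boldsymbol\psi)\in\mathbb{R}^s$, $\boldsymbol\lambda\in\mathbb{R}^t$ has a solution $(\hat{\boldsymbol\omega},\hat{\boldsymbol\lambda})$ such that $\hat{\boldsymbol\omega}\in U_\delta$.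
   Context: Setting. Let $r<s$ and $t$ be positive integers with $s-r\le t\le r$. The parameter is $\boldsymbol\omega=(\omega_1,\dots,\omega_s)^T=(\boldsymbol\phi,\boldsymbol\psi)$ with $\boldsymbol\phi=(\omega_1,\dots,\omega_r)^T$ and $\boldsymbol\psi=(\omega_{r+1},\dots,\omega_s)^T$. The data $\mathbf{x}=(x_1,\dots,x_n)^T$ are $n$ independent observations with density $f(x,\boldsymbol\phi^* )$, where $\boldsymbol\omega^*=(\boldsymbol\phi^*,\boldsymbol\psi^* )$ is the true parameter; the log-likelihood is $\ell(\mathbf{x},\boldsymbol\phi)=\sum_{i=1}^n\log f(x_i,\boldsymbol\phi)$ and depends only on $\boldsymbol\phi$. There are $t$ constraints $\mathbf{h}(\boldsymbol\omega)=(h_1(\boldsymbol\omega),\dots,h_t(\boldsymbol\omega))^T=\mathbf{0}$, and $\mathbf{h}(\boldsymbol\omega^* )=\mathbf{0}$. Notation. $\mathbf{s}(\mathbf{x},\boldsymbol\phi)\in\mathbb{R}^r$ is the score vector $(\partial\ell(\mathbf{x},\boldsymbol\phi)/\partial\omega_i)_{i\le r}$; $\mathbf{J}_{\boldsymbol\omega}$ is the $r\times t$ matrix $(\partial h_j(\boldsymbol\omega)/\partial\omega_i)_{i\le r,\,j\le t}$; $\mathbf{K}_{\boldsymbol\omega}$ is the $(s-r)\times t$ matrix $(\partial h_j(\boldsymbol\omega)/\partial\omega_{r+i})_{i\le s-r,\,j\le t}$; $\mathbf{M}_{\mathbf{x},\boldsymbol\phi}$ is the $r\times r$ matrix $(\partial^2\ell(\mathbf{x},\boldsymbol\phi)/\partial\omega_i\partial\omega_j)$.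 For $\rho>0$, $U_\rho=\{\boldsymbol\omega\in\mathbb{R}^s:\|\boldsymbol\omega-\boldsymbol\omega^*\|\le\rho\}$; $\alpha>0$ is fixed. Conditions on $f$ (Cramér-type, from Aitchison and Silvey 1958). For all $\boldsymbol\omega\in U_\alpha$ and almost all $x$, the partial derivatives of $\log f(x,\boldsymbol\phi)$ with respect to $\omega_1,\dots,\omega_r$ up to order three exist; the first and second order partial derivatives of $f(x,\boldsymbol\phi)$ are bounded in modulus, uniformly for $\boldsymbol\omega\in U_\alpha$, by integrable functions $F_1(x)$, $F_2(x)$; the third order partial derivatives of $\log f(x,\boldsymbol\phi)$ are bounded in modulus, uniformly for $\boldsymbol\omega\in U_\alpha$, by a function $F_3(x)$ with $\int F_3(x)f(x,\boldsymbol\phi^* )\,dx<\kappa_1<\infty$; and the Fisher information matrix $\mathbf{B}_{\boldsymbol\phi^*}=\left(\int \frac{\partial\log f(x,\boldsymbol\phi^* )}{\partial\omega_i}\frac{\partial\log f(x,\boldsymbol\phi^* )}{\partial\omega_j}f(x,\boldsymbol\phi^* )\,dx\right)_{i,j\le r}$ is finite and positive definite. These imply: for any positive $\delta<\alpha$ and $\epsilon<1$ there is $n(\delta,\epsilon)$ such that for every $n\ge n(\delta,\epsilon)$ there is a set $\mathbf{X}_n\subset\mathbb{R}^n$ with: (X1) $\Pr\{\mathbf{X}_n\}>1-\epsilon$; and for every $\mathbf{x}\in\mathbf{X}_n$ (for which $\ell(\mathbf{x},\cdot)$ has the derivatives above on $U_\alpha$): (X2) $\|\mathbf{s}(\mathbf{x},\boldsymbol\phi^*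 )/n\|<\delta^2$; (X3) $\mathbf{M}_{\mathbf{x},\boldsymbol\phi^*}/n=-\mathbf{B}_{\boldsymbol\phi^*}+\delta\,\mathbf{m}_{\mathbf{x},\boldsymbol\phi^*}$ where $\mathbf{m}_{\mathbf{x},\boldsymbol\phi^*}$ is an $r\times r$ matrix with entries of modulus at most $1$; (X4) $\left|\frac1n\frac{\partial^3\ell(\mathbf{x},\boldsymbol\phi)}{\partial\omega_i\partial\omega_j\partial\omega_k}\right|<2\kappa_1$ for all $\boldsymbol\omega\in U_\alpha$ and $i,j,k\le r$, with $\kappa_1$ a constant. Conditions on $\mathbf{h}$. For all $\boldsymbol\omega\in U_\alpha$ the first order partial derivatives of every $h_k$ exist and are continuous in $\boldsymbol\omega$; for all $\boldsymbol\omega\in U_\alpha$ the second order partial derivatives of every $h_k$ exist and are bounded in modulus by a constant $2\kappa_2$; $\operatorname{rank}(\mathbf{J}_{\boldsymbol\omega^*})=t$ and $\operatorname{rank}(\mathbf{K}_{\boldsymbol\omega^*})=s-r$. *)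

theory Defs
  imports "HOL-Probability.Probability"
begin

text \<open>
  The parameter $\omega = (\phi, \psi)$ lives in \<open>(real^'r) \<times> (real^'q)\<close>, where \<open>CARD('r)\<close> is $r$
  and \<open>CARD('q)\<close> is $s - r$. The norm of a product type is the Euclidean one, so \<open>cball \<omega>s \<rho>\<close> is
  $U_\rho$, and \<open>fst ` cball \<omega>s \<rho>\<close> is the set of all $\phi$ that occur in it.
\<close>

text \<open>
  Iterated partial derivatives: for basis vectors \<open>u, v\<close>, \<open>pd [u, v] g\<close> is
  $\partial_u (\partial_v g)$. Since \<open>deriv\<close> is total, existence is the separate predicate
  \<open>pd_exists\<close>; it includes the existence of the lower order derivatives along the coordinate line
  near \<open>p\<close>, so that the difference quotient never involves arbitrary values of \<open>deriv\<close>.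
\<close>

primrec pd :: "'a::real_normed_vector list \<Rightarrow> ('a \<Rightarrow> real) \<Rightarrow> 'a \<Rightarrow> real" where
  "pd [] g = g"
| "pd (v # vs) g = (\<lambda>p. deriv (\<lambda>t. pd vs g (p + t *\<^sub>R v)) 0)"

primrec pd_exists :: "'a::real_normed_vector list \<Rightarrow> ('a \<Rightarrow> real) \<Rightarrow> 'a \<Rightarrow> bool" where
  "pd_exists [] g p \<longleftrightarrow> True"
| "pd_exists (v # vs) g p \<longleftrightarrow>
     (\<forall>\<^sub>F t in nhds 0. pd_exists vs g (p + t *\<^sub>R v)) \<and>
     (\<lambda>t. pd vs g (p + t *\<^sub>R v)) field_differentiable at 0"

definition partials_exist :: "nat \<Rightarrow> ('a::euclidean_space \<Rightarrow> real) \<Rightarrow> 'a set \<Rightarrow> bool" where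
  "partials_exist k g S \<longleftrightarrow>
     (\<forall>vs. set vs \<subseteq> Basis \<and> length vs \<le> k \<longrightarrow> (\<forall>p\<in>S. pd_exists vs g p))"

definition pos_def :: "real^'n^'n \<Rightarrow> bool" where
  "pos_def A \<longleftrightarrow> transpose A = A \<and> (\<forall>v. v \<noteq> 0 \<longrightarrow> 0 < v \<bullet> (A *v v))"

definition obs_dist :: "(real \<Rightarrow> real^'r \<Rightarrow> real) \<Rightarrow> real^'r \<Rightarrow> real measure" where
  "obs_dist f \<phi> = density lborel (\<lambda>x. ennreal (f x \<phi>))"

definition sample_dist :: "(real \<Rightarrow> real^'r \<Rightarrow> real) \<Rightarrow> real^'r \<Rightarrow> nat \<Rightarrow> (nat \<Rightarrow> real) measure" where
  "sample_dist f \<phi> n = Pi\<^sub>M {..<n} (\<lambda>_. obs_dist f \<phi>)"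

definition loglik :: "(real \<Rightarrow> real^'r \<Rightarrow> real) \<Rightarrow> nat \<Rightarrow> (nat \<Rightarrow> real) \<Rightarrow> real^'r \<Rightarrow> real" where
  "loglik f n x \<phi> = (\<Sum>i<n. ln (f (x i) \<phi>))"

definition score :: "(real \<Rightarrow> real^'r \<Rightarrow> real) \<Rightarrow> nat \<Rightarrow> (nat \<Rightarrow> real) \<Rightarrow> real^'r \<Rightarrow> real^'r" where
  "score f n x \<phi> = (\<chi> i. pd [axis i 1] (loglik f n x) \<phi>)"

definition hess :: "(real \<Rightarrow> real^'r \<Rightarrow> real) \<Rightarrow> nat \<Rightarrow> (nat \<Rightarrow> real) \<Rightarrow> real^'r \<Rightarrow> real^'r^'r" where
  "hess f n x \<phi> = (\<chi> i j. pd [axis i 1, axis j 1] (loglik f n x) \<phi>)"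

definition fisher_integrand ::
    "(real \<Rightarrow> real^'r \<Rightarrow> real) \<Rightarrow> real^'r \<Rightarrow> 'r \<Rightarrow> 'r \<Rightarrow> real \<Rightarrow> real" where
  "fisher_integrand f \<phi> i j x =
     pd [axis i 1] (\<lambda>\<theta>. ln (f x \<theta>)) \<phi> * pd [axis j 1] (\<lambda>\<theta>. ln (f x \<theta>)) \<phi> * f x \<phi>"

definition fisher :: "(real \<Rightarrow> real^'r \<Rightarrow> real) \<Rightarrow> real^'r \<Rightarrow> real^'r^'r" where
  "fisher f \<phi> = (\<chi> i j. \<integral>x. fisher_integrand f \<phi> i j x \<partial>lborel)"

definition jacJ :: "((real^'r) \<times> (real^'q) \<Rightarrow> real^'t) \<Rightarrow> (real^'r) \<times> (real^'q) \<Rightarrow> real^'t^'r" where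
  "jacJ h \<omega> = (\<chi> i j. pd [(axis i 1, 0)] (\<lambda>\<omega>'. h \<omega>' $ j) \<omega>)"

definition jacK :: "((real^'r) \<times> (real^'q) \<Rightarrow> real^'t) \<Rightarrow> (real^'r) \<times> (real^'q) \<Rightarrow> real^'t^'q" where
  "jacK h \<omega> = (\<chi> i j. pd [(0, axis i 1)] (\<lambda>\<omega>'. h \<omega>' $ j) \<omega>)"

text \<open>
  Conditions on \<open>log f\<close> are required almost everywhere with respect to the true distribution
  $f(x, \phi^*)\,dx$ (a density may vanish outside a support), and include that the logarithm is
  defined, i.e. \<open>f > 0\<close>. The bounds on the derivatives of \<open>f\<close> itself hold Lebesgue-almost everywhere.
  Exceptional null sets do not depend on the parameter.
\<close>

definition density_conditions ::
    "(real \<Rightarrow> real^'r \<Rightarrow> real) \<Rightarrow> (real^'r) \<times> (real^'q) \<Rightarrow> real \<Rightarrow> real \<Rightarrow> bool" where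
  "density_conditions f \<omega>s \<alpha> \<kappa>1 \<longleftrightarrow>
     (let \<Phi> = fst ` cball \<omega>s \<alpha>; \<phi>s = fst \<omega>s in
      (\<forall>\<phi>\<in>\<Phi>. (\<lambda>x. f x \<phi>) \<in> borel_measurable lborel \<and> (\<forall>x. 0 \<le> f x \<phi>) \<and>
         prob_space (obs_dist f \<phi>)) \<and>
      (AE x in obs_dist f \<phi>s.
         (\<forall>\<phi>\<in>\<Phi>. 0 < f x \<phi>) \<and> partials_exist 3 (\<lambda>\<phi>. ln (f x \<phi>)) \<Phi>) \<and>
      (\<exists>F1. integrable lborel F1 \<and>
         (AE x in lborel. \<forall>\<phi>\<in>\<Phi>. \<forall>i.
            pd_exists [axis i 1] (f x) \<phi> \<and> \<bar>pd [axis i 1] (f x) \<phi>\<bar> \<le> F1 x)) \<and>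
      (\<exists>F2. integrable lborel F2 \<and>
         (AE x in lborel. \<forall>\<phi>\<in>\<Phi>. \<forall>i j.
            pd_exists [axis i 1, axis j 1] (f x) \<phi> \<and>
            \<bar>pd [axis i 1, axis j 1] (f x) \<phi>\<bar> \<le> F2 x)) \<and>
      (\<exists>F3. integrable (obs_dist f \<phi>s) F3 \<and> (\<integral>x. F3 x \<partial>obs_dist f \<phi>s) < \<kappa>1 \<and>
         (AE x in obs_dist f \<phi>s. \<forall>\<phi>\<in>\<Phi>. \<forall>i j k.
            \<bar>pd [axis i 1, axis j 1, axis k 1] (\<lambda>\<phi>. ln (f x \<phi>)) \<phi>\<bar> \<le> F3 x)) \<and>
      (\<forall>i j. integrable lborel (fisher_integrand f \<phi>s i j)) \<and>
      pos_def (fisher f \<phi>s))"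

definition constraint_conditions ::
    "((real^'r) \<times> (real^'q) \<Rightarrow> real^'t) \<Rightarrow> (real^'r) \<times> (real^'q) \<Rightarrow> real \<Rightarrow> real \<Rightarrow> bool" where
  "constraint_conditions h \<omega>s \<alpha> \<kappa>2 \<longleftrightarrow>
     (\<forall>k. \<forall>u\<in>Basis.
        (\<forall>\<omega>\<in>cball \<omega>s \<alpha>. pd_exists [u] (\<lambda>\<omega>'. h \<omega>' $ k) \<omega>) \<and>
        continuous_on (cball \<omega>s \<alpha>) (pd [u] (\<lambda>\<omega>'. h \<omega>' $ k))) \<and>
     (\<forall>k. \<forall>u\<in>Basis. \<forall>v\<in>Basis. \<forall>\<omega>\<in>cball \<omega>s \<alpha>.
        pd_exists [u, v] (\<lambda>\<omega>'. h \<omega>' $ k) \<omega> \<and>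
        \<bar>pd [u, v] (\<lambda>\<omega>'. h \<omega>' $ k) \<omega>\<bar> \<le> 2 * \<kappa>2) \<and>
     rank (jacJ h \<omega>s) = CARD('t) \<and>
     rank (jacK h \<omega>s) = CARD('q)"

text \<open>
  A point $(x_1, \dots, x_n)$ of $\mathbb{R}^n$ is an element of the product space over \<open>{..<n}\<close>.
  For points of a good sample set the log-likelihood is defined and has all partial derivatives up
  to order three.
\<close>

definition good_sample_set ::
    "(real \<Rightarrow> real^'r \<Rightarrow> real) \<Rightarrow> (real^'r) \<times> (real^'q) \<Rightarrow> real \<Rightarrow> real \<Rightarrow> real \<Rightarrow> real \<Rightarrow> nat \<Rightarrow>
      (nat \<Rightarrow> real) set \<Rightarrow> bool" where
  "good_sample_set f \<omega>s \<alpha> \<kappa>1 \<delta> \<epsilon> n X \<longleftrightarrow>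
     (let \<Phi> = fst ` cball \<omega>s \<alpha>; \<phi>s = fst \<omega>s in
      X \<in> sets (sample_dist f \<phi>s n) \<and>
      measure (sample_dist f \<phi>s n) X > 1 - \<epsilon> \<and>
      (\<forall>x\<in>X.
         (\<forall>i<n. \<forall>\<phi>\<in>\<Phi>. 0 < f (x i) \<phi>) \<and> partials_exist 3 (loglik f n x) \<Phi> \<and>
         norm (score f n x \<phi>s /\<^sub>R real n) < \<delta>\<^sup>2 \<and>
         (\<exists>m :: real^'r^'r. (\<forall>i j. \<bar>m $ i $ j\<bar> \<le> 1) \<and>
            hess f n x \<phi>s /\<^sub>R real n = - fisher f \<phi>s + \<delta> *\<^sub>R m) \<and>
         (\<forall>\<phi>\<in>\<Phi>. \<forall>i j k.
            \<bar>1 / real n * pd [axis i 1, axis j 1, axis k 1] (loglik f n x) \<phi>\<bar> < 2 * \<kappa>1)))"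

definition sample_threshold ::
    "(real \<Rightarrow> real^'r \<Rightarrow> real) \<Rightarrow> (real^'r) \<times> (real^'q) \<Rightarrow> real \<Rightarrow> real \<Rightarrow> real \<Rightarrow> real \<Rightarrow> nat \<Rightarrow> bool" where
  "sample_threshold f \<omega>s \<alpha> \<kappa>1 \<delta> \<epsilon> N \<longleftrightarrow>
     0 < N \<and> (\<forall>n\<ge>N. \<exists>X. good_sample_set f \<omega>s \<alpha> \<kappa>1 \<delta> \<epsilon> n X)"

end

theory Submission
  imports Defs
begin

text \<open>
  On the part of the sphere \<open>\<parallel>\<omega> - \<omega>s\<parallel> = \<delta>\<close> where \<open>h\<close> vanishes, full rank of \<open>K\<close> forces \<open>\<parallel>\<phi> - \<phi>s\<parallel> \<ge> c \<delta>\<close>.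
  There the log-likelihood differs from its value at \<open>\<phi>s\<close> by \<open>n\<close> times the negative definite
  term \<open>- (\<phi> - \<phi>s) \<bullet> B (\<phi> - \<phi>s) / 2\<close>, which is at most \<open>- b c\<^sup>2 \<delta>\<^sup>2 / 2\<close>, up to an error \<open>O(\<delta>\<^sup>3)\<close>; so it is
  smaller than at \<open>\<phi>s\<close>. Hence maximizing the penalized log-likelihood over the ball and letting the
  penalty grow yields a constrained critical point in the interior, and the injectivity of \<open>J\<close>
  near \<open>\<omega>s\<close> keeps the multipliers bounded.
\<close>

subsection \<open>Functions with partial derivatives\<close>

lemma has_real_derivative_shift:
  fixes g :: "'a::real_vector \<Rightarrow> real"
  assumes "((\<lambda>t. g (p + s *\<^sub>R u + t *\<^sub>R u)) has_real_derivative D) (at 0)"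
  shows "((\<lambda>t. g (p + t *\<^sub>R u)) has_real_derivative D) (at s)"
proof -
  have "p + s *\<^sub>R u + t *\<^sub>R u = p + (t + s) *\<^sub>R u" for t
    by (simp add: algebra_simps)
  then have "((\<lambda>t. g (p + (t + s) *\<^sub>R u)) has_real_derivative D) (at 0)"
    using assms by (simp only:)
  then show ?thesis
    using DERIV_shift[of "\<lambda>t. g (p + t *\<^sub>R u)" D 0 s] by simp
qed

text \<open>The increment is telescoped along a path from \<open>x\<close> to \<open>y\<close> that changes one coordinate at a
  time; such a path never leaves the ball.\<close>

lemma partials_mean_value:
  fixes g :: "'a::euclidean_space \<Rightarrow> real"
  assumes deriv: "\<And>z u. z \<in> cball x \<rho> \<Longrightarrow> u \<in> Basis \<Longrightarrow>
      ((\<lambda>t. g (z + t *\<^sub>R u)) has_real_derivative g' u z) (at 0)"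
    and bound: "\<And>z u. z \<in> cball x \<rho> \<Longrightarrow> u \<in> Basis \<Longrightarrow> \<bar>g' u z - L \<bullet> u\<bar> \<le> e"
    and y: "y \<in> cball x \<rho>"
  shows "\<bar>g y - g x - L \<bullet> (y - x)\<bar> \<le> e * DIM('a) * norm (y - x)"
proof -
  define w where "w = y - x"
  \<comment> \<open>\<open>P A\<close> keeps the coordinates of \<open>w\<close> indexed by
    \<open>A\<close>; adding basis vectors one at a time leads from \<open>x\<close> to
    \<open>y\<close>.\<close>
  define P where "P A = (\<Sum>u\<in>A. (w \<bullet> u) *\<^sub>R u)" for A :: "'a set"
  have P_inner: "P A \<bullet> v = (if v \<in> A then w \<bullet> v else 0)" if "A \<subseteq> Basis" "v \<in> Basis" for A v
  proof -
    have fin: "finite A" using that by (auto intro: finite_subset[OF _ finite_Basis])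
    have "P A \<bullet> v = (\<Sum>u\<in>A. if u = v then w \<bullet> v else 0)"
      unfolding P_def inner_sum_left using that
      by (intro sum.cong) (auto simp: inner_Basis subsetD)
    then show ?thesis using fin by simp
  qed
  \<comment> \<open>This basis vector serves to derive \<open>0 \<le> e\<close>: at
    \<open>x\<close>, \<open>bound\<close> places \<open>e\<close> above an absolute value.\<close>
  obtain u0 :: 'a where u0: "u0 \<in> Basis"
    using nonempty_Basis by blast
  have "x \<in> cball x \<rho>"
    using y zero_le_dist[of x y] unfolding mem_cball by (simp del: zero_le_dist)
  then have e0: "0 \<le> e"
    using bound[of x u0] u0 by linarith
  have step: "\<bar>g (x + P (insert u A)) - g (x + P A) - L \<bullet> (P (insert u A) - P A)\<bar> \<le> e * norm w"
    if A: "insert u A \<subseteq> Basis" and u: "u \<notin> A" for u A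
  proof -
    have fin: "finite A" using A by (auto intro: finite_subset[OF _ finite_Basis])
    have Pu: "P (insert u A) = P A + (w \<bullet> u) *\<^sub>R u"
      using fin u by (simp add: P_def)
    define q where "q s = x + P A + s *\<^sub>R (w \<bullet> u) *\<^sub>R u" for s :: real
    \<comment> \<open>Each coordinate of the displacement from \<open>x\<close> is at most that of
      \<open>w\<close> in modulus, so its norm is at most \<open>norm w\<close>.\<close>
    have q_in: "q s \<in> cball x \<rho>" if s: "0 \<le> s" "s \<le> 1" for s
    proof -
      have "norm (P A + s *\<^sub>R (w \<bullet> u) *\<^sub>R u) \<le> norm w"
      proof (rule norm_le_componentwise)
        fix v :: 'a assume v: "v \<in> Basis"
        have "(P A + s *\<^sub>R (w \<bullet> u) *\<^sub>R u) \<bullet> v = (if v \<in> A then w \<bullet> v else if v = u then s * (w \<bullet> v) else 0)"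
          using A u v P_inner[of A v] by (auto simp: inner_add_left inner_Basis)
        then show "\<bar>(P A + s *\<^sub>R (w \<bullet> u) *\<^sub>R u) \<bullet> v\<bar> \<le> \<bar>w \<bullet> v\<bar>"
          using s by (auto simp: abs_mult mult_left_le_one_le)
      qed
      then show ?thesis
        using y by (simp add: q_def dist_norm w_def norm_minus_commute algebra_simps)
    qed
    have der: "((\<lambda>s. g (q s)) has_real_derivative (w \<bullet> u) * g' u (q s)) (at s)"
      if s: "0 \<le> s" "s \<le> 1" for s
    proof -
      have "((\<lambda>t. g (x + P A + t *\<^sub>R u)) has_real_derivative g' u (q s)) (at (s * (w \<bullet> u)))"
        using deriv[OF q_in[OF s]] A
        by (intro has_real_derivative_shift[of g "x + P A" "s * (w \<bullet> u)" u]) (simp add: q_def)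
      moreover have "((\<lambda>s. s * (w \<bullet> u)) has_real_derivative w \<bullet> u) (at s)"
        by (auto intro!: derivative_eq_intros)
      ultimately have "((\<lambda>s. g (x + P A + (s * (w \<bullet> u)) *\<^sub>R u)) has_real_derivative g' u (q s) * (w \<bullet> u)) (at s)"
        by (rule DERIV_chain2)
      then show ?thesis
        by (simp add: q_def mult.commute)
    qed
    \<comment> \<open>The edge in direction \<open>u\<close> is traversed with speed
      \<open>w \<bullet> u\<close>; the mean value theorem reduces its increment to the partial
      derivative at one point of the edge.\<close>
    obtain s where s: "0 < s" "s < 1" and eq: "g (q 1) - g (q 0) = (1 - 0) * ((w \<bullet> u) * g' u (q s))"
      using MVT2[of 0 1 "\<lambda>s. g (q s)" "\<lambda>s. (w \<bullet> u) * g' u (q s)"] der by auto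
    have "g (x + P (insert u A)) - g (x + P A) - L \<bullet> (P (insert u A) - P A)
        = (w \<bullet> u) * (g' u (q s) - L \<bullet> u)"
      using eq by (simp add: q_def Pu algebra_simps)
    moreover have "\<bar>(w \<bullet> u) * (g' u (q s) - L \<bullet> u)\<bar> \<le> norm w * e"
      unfolding abs_mult using A s q_in e0
      by (intro mult_mono bound Basis_le_norm) auto
    ultimately show ?thesis by (simp add: mult.commute)
  qed
  have "A \<subseteq> Basis \<Longrightarrow> \<bar>g (x + P A) - g x - L \<bullet> P A\<bar> \<le> e * card A * norm w" if "finite A" for A
    using that
  proof (induction A rule: finite_induct)
    case empty
    then show ?case by (simp add: P_def)
  next
    case (insert u A)
    have "\<bar>g (x + P (insert u A)) - g x - L \<bullet> P (insert u A)\<bar>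
        \<le> \<bar>g (x + P A) - g x - L \<bullet> P A\<bar> + e * norm w"
      using step[OF insert.prems insert.hyps(2)] by (simp add: inner_diff_right)
    also have "\<dots> \<le> e * card (insert u A) * norm w"
      using insert by (simp add: algebra_simps)
    finally show ?case .
  qed
  from this[OF finite_Basis] show ?thesis
    by (simp add: P_def euclidean_representation w_def)
qed

text \<open>The mean value estimate with \<open>L = 0\<close> bounds increments by a multiple of the
  distance: taken from an interior point this gives continuity, taken from \<open>c\<close>
  boundedness. Continuity is stated on the open ball because the coordinate path needs a ball about
  its own starting point inside the domain.\<close>

lemma bounded_partials:
  fixes g :: "'a::euclidean_space \<Rightarrow> real"
  assumes deriv: "\<And>z u. z \<in> cball c \<rho> \<Longrightarrow> u \<in> Basis \<Longrightarrow>
      ((\<lambda>t. g (z + t *\<^sub>R u)) has_real_derivative g' u z) (at 0)"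
    and bound: "\<And>z u. z \<in> cball c \<rho> \<Longrightarrow> u \<in> Basis \<Longrightarrow> \<bar>g' u z\<bar> \<le> e"
  shows continuous_on_bounded_partials: "continuous_on (ball c \<rho>) g"
    and bounded_bounded_partials: "\<exists>M. \<forall>z\<in>cball c \<rho>. \<bar>g z\<bar> \<le> M"
proof -
  have "isCont g x" if x: "x \<in> ball c \<rho>" for x
  proof -
    obtain r where r: "0 < r" "cball x r \<subseteq> ball c \<rho>"
      using x open_contains_cball open_ball by metis
    then have sub: "cball x r \<subseteq> cball c \<rho>" using ball_subset_cball by blast
    have "\<bar>g y - g x\<bar> \<le> e * DIM('a) * norm (y - x)" if "y \<in> cball x r" for y
    proof -
      have "\<bar>g y - g x - 0 \<bullet> (y - x)\<bar> \<le> e * DIM('a) * norm (y - x)"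
        by (rule partials_mean_value[OF _ _ that, where g' = g'])
          (use sub deriv bound in \<open>auto dest: subsetD\<close>)
      then show ?thesis by simp
    qed
    then have "\<forall>\<^sub>F y in at x. norm (g y - g x) \<le> e * DIM('a) * norm (y - x)"
      using r(1) by (auto simp: eventually_at dist_commute intro!: exI[of _ r])
    moreover have "((\<lambda>y. e * DIM('a) * norm (y - x)) \<longlongrightarrow> 0) (at x)"
      by (auto intro!: tendsto_eq_intros)
    ultimately have "((\<lambda>y. g y - g x) \<longlongrightarrow> 0) (at x)"
      by (rule Lim_null_comparison)
    then show ?thesis by (simp add: isCont_def LIM_zero_iff)
  qed
  then show "continuous_on (ball c \<rho>) g"
    by (simp add: continuous_at_imp_continuous_on)
  have "\<bar>g z\<bar> \<le> \<bar>g c\<bar> + \<bar>e\<bar> * DIM('a) * \<rho>" if z: "z \<in> cball c \<rho>" for z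
  proof -
    have "\<bar>g z - g c\<bar> \<le> \<bar>e\<bar> * DIM('a) * norm (z - c)"
      using partials_mean_value[of c \<rho> g g' 0 "\<bar>e\<bar>" z] deriv bound z by force
    also have "\<dots> \<le> \<bar>e\<bar> * DIM('a) * \<rho>"
      using z by (intro mult_left_mono) (auto simp: dist_norm norm_minus_commute)
    finally show ?thesis by linarith
  qed
  then show "\<exists>M. \<forall>z\<in>cball c \<rho>. \<bar>g z\<bar> \<le> M" by blast
qed

subsection \<open>Lagrange multipliers by penalization\<close>

text \<open>The derivative along \<open>u\<close> vanishes at an interior minimum. The penalty
  contributes the derivatives of \<open>H\<close> weighted by \<open>a * H w\<close>, which
  therefore acts as an approximate multiplier.\<close>

lemma penalty_stationary:
  fixes G :: "'a::euclidean_space \<Rightarrow> real" and H :: "'a \<Rightarrow> real^'t"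
  assumes dG: "((\<lambda>t. G (w + t *\<^sub>R u)) has_real_derivative G') (at 0)"
    and dH: "\<And>k. ((\<lambda>t. H (w + t *\<^sub>R u) $ k) has_real_derivative H' k) (at 0)"
    and w: "w \<in> ball c \<delta>"
    and min: "\<And>z. z \<in> ball c \<delta> \<Longrightarrow> G w + a / 2 * (H w \<bullet> H w) \<le> G z + a / 2 * (H z \<bullet> H z)"
    and u: "u \<in> Basis"
  shows "G' + (\<Sum>k\<in>UNIV. (a * H w $ k) * H' k) = 0"
proof -
  let ?F = "\<lambda>t. G (w + t *\<^sub>R u) + a / 2 * (\<Sum>k\<in>UNIV. (H (w + t *\<^sub>R u) $ k)\<^sup>2)"
  have "(?F has_real_derivative G' + a / 2 * (\<Sum>k\<in>UNIV. 2 * (H' k * H w $ k))) (at 0)"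
    by (auto intro!: derivative_eq_intros dG dH)
  then have *: "(?F has_real_derivative G' + (\<Sum>k\<in>UNIV. (a * H w $ k) * H' k)) (at 0)"
    by (simp add: sum_distrib_left mult_ac)
  obtain r where r: "0 < r" "ball w r \<subseteq> ball c \<delta>"
    using w open_contains_ball open_ball by metis
  have "?F 0 \<le> ?F t" if "\<bar>0 - t\<bar> < r" for t
  proof -
    have "w + t *\<^sub>R u \<in> ball w r" using that u by (simp add: dist_norm)
    then have "w + t *\<^sub>R u \<in> ball c \<delta>" using r by blast
    from min[OF this] show ?thesis
      by (simp add: inner_vec_def power2_eq_square)
  qed
  then show ?thesis
    using DERIV_local_min[OF * r(1)] by blast
qed

text \<open>The multiplier is the limit of \<open>j * H w\<^sub>j\<close>, where \<open>w\<^sub>j\<close> minimizes \<open>G + j/2 * |H|\<^sup>2\<close>. This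
  needs neither the implicit function theorem nor differentiability beyond partial derivatives.\<close>

lemma penalty_lagrange:
  fixes G :: "'a::euclidean_space \<Rightarrow> real" and H :: "'a \<Rightarrow> real^'t"
  assumes \<delta>: "0 < \<delta>"
    and dG: "\<And>w u. w \<in> ball c \<delta> \<Longrightarrow> u \<in> Basis \<Longrightarrow>
      ((\<lambda>t. G (w + t *\<^sub>R u)) has_real_derivative G' u w) (at 0)"
    and dH: "\<And>w u k. w \<in> ball c \<delta> \<Longrightarrow> u \<in> Basis \<Longrightarrow>
      ((\<lambda>t. H (w + t *\<^sub>R u) $ k) has_real_derivative H' u k w) (at 0)"
    and contG: "continuous_on (cball c \<delta>) G" and contH: "continuous_on (cball c \<delta>) H"
    and contG': "\<And>u. u \<in> Basis \<Longrightarrow> continuous_on (cball c \<delta>) (G' u)"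
    and contH': "\<And>u k. u \<in> Basis \<Longrightarrow> continuous_on (cball c \<delta>) (H' u k)"
    and Hc: "H c = 0"
    and boundary: "\<And>w. dist c w = \<delta> \<Longrightarrow> H w = 0 \<Longrightarrow> G c < G w"
    and m: "0 < m"
    and below: "\<And>w l. w \<in> cball c \<delta> \<Longrightarrow>
      m * norm l \<le> (\<Sum>u\<in>Basis. \<bar>\<Sum>k\<in>UNIV. l $ k * H' u k w\<bar>)"
  shows "\<exists>w l. w \<in> cball c \<delta> \<and> H w = 0 \<and>
    (\<forall>u\<in>Basis. G' u w + (\<Sum>k\<in>UNIV. l $ k * H' u k w) = 0)"
proof -
  let ?S = "cball c \<delta>"
  have "\<exists>w\<in>?S. \<forall>z\<in>?S. G w + real j / 2 * (H w \<bullet> H w) \<le> G z + real j / 2 * (H z \<bullet> H z)" for j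
    using \<delta> by (intro continuous_attains_inf) (auto intro!: continuous_intros contG contH)
  then obtain w where wS: "\<And>j. w j \<in> ?S"
    and wmin: "\<And>j z. z \<in> ?S \<Longrightarrow>
      G (w j) + real j / 2 * (H (w j) \<bullet> H (w j)) \<le> G z + real j / 2 * (H z \<bullet> H z)"
    by metis
  \<comment> \<open>Comparison with the centre, where the penalty vanishes.\<close>
  have wc: "G (w j) + real j / 2 * (H (w j) \<bullet> H (w j)) \<le> G c" for j
    using wmin[of c j] \<delta> Hc by simp
  have Gw: "G (w j) \<le> G c" for j
  proof -
    have "0 \<le> real j / 2 * (H (w j) \<bullet> H (w j))" by simp
    then show ?thesis using wc[of j] by linarith
  qed
  obtain r w0 where r: "strict_mono r" and w0: "w0 \<in> ?S" and lim: "(w \<circ> r) \<longlonglongrightarrow> w0"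
    using compact_cball[of c \<delta>] wS unfolding compact_def by metis
  have limc: "(\<lambda>j. F (w (r j))) \<longlonglongrightarrow> F w0" if "continuous_on ?S F" for F :: "'a \<Rightarrow> 'b::topological_space"
    using continuous_on_tendsto_compose[OF that lim w0] wS by (simp add: o_def)
  have G0: "G w0 \<le> G c"
    by (rule LIMSEQ_le_const2[OF limc[OF contG]]) (use Gw in auto)
  have H0: "H w0 = 0"
  proof -
    \<comment> \<open>A lower bound for \<open>G\<close> on the ball caps the penalty at
      \<open>w j\<close> by \<open>G c - G g0\<close>. Since \<open>r j \<ge> j\<close>, the squared
      norm of \<open>H\<close> is of order \<open>1 / j\<close> along the subsequence.\<close>
    obtain g0 where g0: "\<And>z. z \<in> ?S \<Longrightarrow> G g0 \<le> G z"
      using continuous_attains_inf[OF compact_cball _ contG] \<delta> by fastforce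
    let ?K = "2 * (G c - G g0)"
    have K: "real j * (H (w j) \<bullet> H (w j)) \<le> ?K" for j
      using wc[of j] g0[OF wS[of j]] by (simp add: field_simps)
    have "H (w (r j)) \<bullet> H (w (r j)) \<le> ?K * inverse (real j)" if "0 < j" for j
    proof -
      have "real j * (H (w (r j)) \<bullet> H (w (r j))) \<le> real (r j) * (H (w (r j)) \<bullet> H (w (r j)))"
        using seq_suble[OF r] by (intro mult_right_mono) auto
      with K[of "r j"] have "real j * (H (w (r j)) \<bullet> H (w (r j))) \<le> ?K" by linarith
      then show ?thesis using that by (simp add: field_simps)
    qed
    then have ev: "\<forall>\<^sub>F j in sequentially. H (w (r j)) \<bullet> H (w (r j)) \<le> ?K * inverse (real j)"
      by (auto simp: eventually_sequentially intro!: exI[of _ 1])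
    have "(\<lambda>j. ?K * inverse (real j)) \<longlonglongrightarrow> ?K * 0"
      by (intro tendsto_intros LIMSEQ_inverse_real_of_nat lim_inverse_n)
    moreover have "(\<lambda>j. H (w (r j)) \<bullet> H (w (r j))) \<longlonglongrightarrow> H w0 \<bullet> H w0"
      by (intro tendsto_intros limc contH)
    ultimately have "H w0 \<bullet> H w0 \<le> ?K * 0"
      using ev by (intro tendsto_le[OF sequentially_bot])
    then show ?thesis using inner_ge_zero[of "H w0"] by simp
  qed
  \<comment> \<open>The limit satisfies \<open>H w0 = 0\<close> and \<open>G w0 \<le> G c\<close>,
    so \<open>boundary\<close> keeps it off the sphere.\<close>
  have "w0 \<in> ball c \<delta>"
    using w0 boundary[of w0] G0 H0 by fastforce
  then have "\<forall>\<^sub>F j in sequentially. w (r j) \<in> ball c \<delta>"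
    using topological_tendstoD[OF lim open_ball] by (simp add: o_def)
  then obtain J where J: "\<And>j. j \<ge> J \<Longrightarrow> w (r j) \<in> ball c \<delta>"
    by (auto simp: eventually_sequentially)
  \<comment> \<open>Dropping the first \<open>J\<close> terms leaves only interior minimizers, to
    which the stationarity condition applies.\<close>
  define v where "v j = w (r (j + J))" for j
  define l where "l j = real (r (j + J)) *\<^sub>R H (v j)" for j
  have stat: "G' u (v j) + (\<Sum>k\<in>UNIV. l j $ k * H' u k (v j)) = 0" if u: "u \<in> Basis" for u j
  proof -
    have vb: "v j \<in> ball c \<delta>" using J by (simp add: v_def)
    show ?thesis
      using penalty_stationary[OF dG[OF vb u] dH[OF vb u] vb _ u, of "real (r (j + J))"]
        wmin[of _ "r (j + J)"]
      by (simp add: l_def v_def less_imp_le)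
  qed
  have limv: "(\<lambda>j. F (v j)) \<longlonglongrightarrow> F w0" if "continuous_on ?S F" for F :: "'a \<Rightarrow> real"
    using LIMSEQ_ignore_initial_segment[OF limc[OF that]] by (simp add: v_def)
  have "(\<lambda>j. \<Sum>u\<in>Basis. \<bar>G' u (v j)\<bar>) \<longlonglongrightarrow> (\<Sum>u\<in>Basis. \<bar>G' u w0\<bar>)"
    by (intro tendsto_intros limv contG')
  then have "Bseq (\<lambda>j. \<Sum>u\<in>Basis. \<bar>G' u (v j)\<bar>)"
    by (intro convergent_imp_Bseq convergentI)
  then obtain M where "0 < M" and M: "\<forall>j. norm (\<Sum>u\<in>Basis. \<bar>G' u (v j)\<bar>) \<le> M"
    by (rule BseqE)
  \<comment> \<open>By stationarity the right side of \<open>below\<close> is the sum of the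
    \<open>\<bar>G' u (v j)\<bar>\<close>, which is bounded because it converges.\<close>
  have "norm (l j) \<le> M / m" for j
  proof -
    have "m * norm (l j) \<le> (\<Sum>u\<in>Basis. \<bar>\<Sum>k\<in>UNIV. l j $ k * H' u k (v j)\<bar>)"
      using below[of "v j"] wS by (simp add: v_def)
    also have "\<dots> = (\<Sum>u\<in>Basis. \<bar>G' u (v j)\<bar>)"
    proof (rule sum.cong[OF refl])
      fix u :: 'a assume "u \<in> Basis"
      from stat[OF this, of j]
      show "\<bar>\<Sum>k\<in>UNIV. l j $ k * H' u k (v j)\<bar> = \<bar>G' u (v j)\<bar>" by linarith
    qed
    also have "\<dots> \<le> M" using spec[OF M, of j] by simp
    finally show ?thesis using m by (simp add: field_simps)
  qed
  then have "\<forall>j. l j \<in> cball 0 (M / m)" by simp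
  then obtain r' l0 where r': "strict_mono r'" and liml: "(l \<circ> r') \<longlonglongrightarrow> l0"
    using compact_cball[of 0 "M / m"] unfolding compact_def by metis
  have "G' u w0 + (\<Sum>k\<in>UNIV. l0 $ k * H' u k w0) = 0" if u: "u \<in> Basis" for u
  proof -
    have limv': "(\<lambda>j. F (v (r' j))) \<longlonglongrightarrow> F w0" if "continuous_on ?S F" for F :: "'a \<Rightarrow> real"
      using LIMSEQ_subseq_LIMSEQ[OF limv[OF that] r'] by (simp add: o_def)
    have "(\<lambda>j. G' u (v (r' j)) + (\<Sum>k\<in>UNIV. l (r' j) $ k * H' u k (v (r' j))))
        \<longlonglongrightarrow> G' u w0 + (\<Sum>k\<in>UNIV. l0 $ k * H' u k w0)"
      using liml by (intro tendsto_intros limv' contG' contH' u) (simp add: o_def)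
    then show ?thesis using stat[OF u] LIMSEQ_unique[OF _ tendsto_const] by simp
  qed
  then show ?thesis using w0 H0 by blast
qed


subsection \<open>The likelihood near the true parameter\<close>

lemma pd_Cons_has_real_derivative:
  "pd_exists (v # vs) g p \<Longrightarrow>
    ((\<lambda>t. pd vs g (p + t *\<^sub>R v)) has_real_derivative pd (v # vs) g p) (at 0)"
  by (simp add: field_differentiable_derivI)

lemma Basis_cart: "(Basis :: (real^'n) set) = range (\<lambda>i. axis i 1)"
  by (auto simp: Basis_vec_def)

lemma quadratic_form_has_derivative:
  fixes A :: "real^'n^'n"
  assumes "transpose A = A"
  shows "((\<lambda>t. (a + t *\<^sub>R u) \<bullet> (A *v (a + t *\<^sub>R u))) has_real_derivative 2 * (u \<bullet> (A *v a))) (at 0)"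
proof -
  have sym: "a \<bullet> (A *v u) = u \<bullet> (A *v a)"
    by (metis assms dot_lmul_matrix inner_commute transpose_matrix_vector)
  have "(a + t *\<^sub>R u) \<bullet> (A *v (a + t *\<^sub>R u))
      = a \<bullet> (A *v a) + t * (2 * (u \<bullet> (A *v a))) + t\<^sup>2 * (u \<bullet> (A *v u))" for t
    by (simp add: matrix_vector_right_distrib matrix_vector_mult_scaleR inner_add_left
        inner_add_right sym power2_eq_square algebra_simps)
  then show ?thesis
    by (auto intro!: derivative_eq_intros)
qed

text \<open>The form attains its minimum on the compact unit sphere, and that minimum is positive;
  homogeneity of degree two extends the bound to all vectors.\<close>

lemma pos_def_lower_bound:
  fixes A :: "real^'n^'n"
  assumes "pos_def A"
  shows "\<exists>b>0. \<forall>v. b * (norm v)\<^sup>2 \<le> v \<bullet> (A *v v)"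
proof -
  have "sphere (0 :: real^'n) 1 \<noteq> {}"
    using norm_axis_1 by (metis dist_0_norm emptyE mem_sphere)
  moreover have "continuous_on (sphere 0 1) (\<lambda>v. v \<bullet> (A *v v))"
    by (intro continuous_intros linear_continuous_on matrix_vector_mul_bounded_linear)
  ultimately obtain w where w: "w \<in> sphere 0 1"
    and min: "\<And>z. z \<in> sphere 0 1 \<Longrightarrow> w \<bullet> (A *v w) \<le> z \<bullet> (A *v z)"
    using continuous_attains_inf[OF compact_sphere] by blast
  have "(w \<bullet> (A *v w)) * (norm v)\<^sup>2 \<le> v \<bullet> (A *v v)" for v
  proof (cases "v = 0")
    case False
    have "w \<bullet> (A *v w) \<le> (v /\<^sub>R norm v) \<bullet> (A *v (v /\<^sub>R norm v))"
      using False by (intro min) simp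
    also have "\<dots> = (v \<bullet> (A *v v)) / (norm v)\<^sup>2"
      by (simp add: matrix_vector_mult_scaleR power2_eq_square divide_inverse)
    finally show ?thesis using False by (simp add: field_simps)
  qed simp
  moreover have "0 < w \<bullet> (A *v w)"
    using assms w unfolding pos_def_def by (metis dist_0_norm mem_sphere norm_zero zero_neq_one)
  ultimately show ?thesis by blast
qed

text \<open>The mean value estimate is applied to the second and first order derivatives of \<open>l\<close> and
  finally to \<open>l z + n/2 * (z - p) \<bullet> B (z - p)\<close>, whose partial derivatives are of order \<open>\<delta>\<^sup>2\<close>.\<close>

lemma quadratic_approximation:
  fixes l :: "real^'r \<Rightarrow> real" and B :: "real^'r^'r"
  assumes n: "0 < n" and \<kappa>: "0 \<le> \<kappa>"
    and ex: "partials_exist 3 l (cball p \<delta>)" and sym: "transpose B = B"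
    and grad: "\<And>i. \<bar>pd [axis i 1] l p\<bar> \<le> n * \<delta>\<^sup>2"
    and hess: "\<And>i j. \<bar>pd [axis i 1, axis j 1] l p + n * B $ i $ j\<bar> \<le> n * \<delta>"
    and third: "\<And>z i j k. z \<in> cball p \<delta> \<Longrightarrow>
      \<bar>pd [axis i 1, axis j 1, axis k 1] l z\<bar> \<le> n * \<kappa>"
    and z: "z \<in> cball p \<delta>"
  defines "R \<equiv> real CARD('r)"
  shows "\<bar>l z - l p + n / 2 * ((z - p) \<bullet> (B *v (z - p)))\<bar>
    \<le> n * ((1 + (1 + \<kappa> * R) * R) * R * \<delta> ^ 3)"
proof -
  have \<delta>: "0 \<le> \<delta>" using z zero_le_dist[of p z] unfolding mem_cball by linarith
  have R: "0 \<le> R" by (simp add: R_def)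
  have dist: "norm (y - p) \<le> \<delta>" if "y \<in> cball p \<delta>" for y
    using that by (simp add: dist_norm norm_minus_commute)
  have pde: "pd_exists vs l y"
    if "y \<in> cball p \<delta>" "set vs \<subseteq> range (\<lambda>i. axis i 1)" "length vs \<le> 3" for y vs
    using ex that unfolding partials_exist_def Basis_cart by blast
  have le_R: "e * DIM(real^'r) * norm (y - p) \<le> e * R * \<delta>" if "0 \<le> e" "y \<in> cball p \<delta>" for e :: real and y
    using that dist by (simp add: R_def mult_left_mono)
  \<comment> \<open>The error is \<open>n * \<delta>\<close> at \<open>p\<close>, plus the effect of
    third derivatives of size at most \<open>n * \<kappa>\<close> over a distance at most
    \<open>\<delta>\<close>.\<close>
  have second: "\<bar>pd [axis i 1, axis j 1] l y + n * B $ i $ j\<bar> \<le> n * \<delta> * (1 + \<kappa> * R)"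
    if y: "y \<in> cball p \<delta>" for i j y
  proof -
    have "\<bar>pd [axis i 1, axis j 1] l y - pd [axis i 1, axis j 1] l p - 0 \<bullet> (y - p)\<bar>
        \<le> n * \<kappa> * DIM(real^'r) * norm (y - p)"
    proof (rule partials_mean_value[OF _ _ y])
      fix w u :: "real^'r" assume w: "w \<in> cball p \<delta>" and "u \<in> Basis"
      then obtain k where u: "u = axis k 1" by (auto simp: Basis_cart)
      show "((\<lambda>t. pd [axis i 1, axis j 1] l (w + t *\<^sub>R u))
          has_real_derivative pd [u, axis i 1, axis j 1] l w) (at 0)"
        by (rule pd_Cons_has_real_derivative, rule pde) (use w in \<open>auto simp: u\<close>)
      show "\<bar>pd [u, axis i 1, axis j 1] l w - 0 \<bullet> u\<bar> \<le> n * \<kappa>"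
        using third[OF w, of k i j] by (simp add: u)
    qed
    also have "\<dots> \<le> n * \<kappa> * R * \<delta>"
      using n \<kappa> y by (intro le_R) auto
    finally have "\<bar>pd [axis i 1, axis j 1] l y - pd [axis i 1, axis j 1] l p\<bar> \<le> n * \<kappa> * R * \<delta>"
      by (simp del: pd.simps)
    moreover have "n * \<delta> * (1 + \<kappa> * R) = n * \<delta> + n * \<kappa> * R * \<delta>"
      by (simp add: algebra_simps)
    ultimately show ?thesis
      using hess[of i j] by linarith
  qed
  \<comment> \<open>The same scheme one order lower: an error \<open>n * \<delta>\<^sup>2\<close> at
    \<open>p\<close>, plus the second order error accumulated over a distance at most
    \<open>\<delta>\<close>.\<close>
  have first: "\<bar>pd [axis j 1] l y + n * (B *v (y - p)) $ j\<bar> \<le> n * \<delta>\<^sup>2 * (1 + (1 + \<kappa> * R) * R)"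
    if y: "y \<in> cball p \<delta>" for j y
  proof -
    have "\<bar>pd [axis j 1] l y - pd [axis j 1] l p - (- n *\<^sub>R B $ j) \<bullet> (y - p)\<bar>
        \<le> n * \<delta> * (1 + \<kappa> * R) * DIM(real^'r) * norm (y - p)"
    proof (rule partials_mean_value[OF _ _ y])
      fix w u :: "real^'r" assume w: "w \<in> cball p \<delta>" and "u \<in> Basis"
      then obtain k where u: "u = axis k 1" by (auto simp: Basis_cart)
      show "((\<lambda>t. pd [axis j 1] l (w + t *\<^sub>R u)) has_real_derivative pd [u, axis j 1] l w) (at 0)"
        by (rule pd_Cons_has_real_derivative, rule pde) (use w in \<open>auto simp: u\<close>)
      \<comment> \<open>The slope supplies the entry \<open>B $ j $ k\<close>, whereas
        \<open>second\<close> concerns \<open>B $ k $ j\<close>.\<close>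
      have "B $ j $ k = B $ k $ j"
        using arg_cong[OF sym, of "\<lambda>A. A $ k $ j"] by (simp add: transpose_def)
      then show "\<bar>pd [u, axis j 1] l w - (- n *\<^sub>R B $ j) \<bullet> u\<bar> \<le> n * \<delta> * (1 + \<kappa> * R)"
        using second[OF w, of k j] by (simp add: u inner_axis)
    qed
    also have "\<dots> \<le> n * \<delta> * (1 + \<kappa> * R) * R * \<delta>"
      using n \<delta> \<kappa> R y by (intro le_R) auto
    finally have "\<bar>pd [axis j 1] l y - pd [axis j 1] l p + n * (B *v (y - p)) $ j\<bar>
        \<le> n * \<delta>\<^sup>2 * ((1 + \<kappa> * R) * R)"
      by (simp add: matrix_vector_mul_component power2_eq_square mult_ac)
    with grad[of j] show ?thesis
      by (simp add: distrib_left)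
  qed
  \<comment> \<open>Adding the quadratic form cancels the main part of the gradient. As
    \<open>q p = l p\<close>, the increment of \<open>q\<close> is the quantity to be
    bounded.\<close>
  define q where "q y = l y + n / 2 * ((y - p) \<bullet> (B *v (y - p)))" for y
  have "\<bar>q z - q p - 0 \<bullet> (z - p)\<bar>
      \<le> n * \<delta>\<^sup>2 * (1 + (1 + \<kappa> * R) * R) * DIM(real^'r) * norm (z - p)"
  proof (rule partials_mean_value[OF _ _ z])
    fix w u :: "real^'r" assume w: "w \<in> cball p \<delta>" and "u \<in> Basis"
    then obtain k where u: "u = axis k 1" by (auto simp: Basis_cart)
    have "((\<lambda>t. pd [] l (w + t *\<^sub>R u)) has_real_derivative pd [u] l w) (at 0)"
      by (rule pd_Cons_has_real_derivative, rule pde) (use w in \<open>auto simp: u\<close>)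
    moreover have "((\<lambda>t. (w + t *\<^sub>R u - p) \<bullet> (B *v (w + t *\<^sub>R u - p)))
        has_real_derivative 2 * (u \<bullet> (B *v (w - p)))) (at 0)"
      using quadratic_form_has_derivative[OF sym, of "w - p" u] by (simp add: algebra_simps)
    ultimately show "((\<lambda>t. q (w + t *\<^sub>R u)) has_real_derivative pd [u] l w + n * (u \<bullet> (B *v (w - p)))) (at 0)"
      unfolding q_def by (auto intro!: derivative_eq_intros)
    show "\<bar>pd [u] l w + n * (u \<bullet> (B *v (w - p))) - 0 \<bullet> u\<bar> \<le> n * \<delta>\<^sup>2 * (1 + (1 + \<kappa> * R) * R)"
      using first[OF w, of k] by (simp add: u inner_axis')
  qed
  also have "\<dots> \<le> n * \<delta>\<^sup>2 * (1 + (1 + \<kappa> * R) * R) * R * \<delta>"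
    using n \<delta> \<kappa> R z by (intro le_R) auto
  finally show ?thesis
    by (simp add: q_def power2_eq_square power3_eq_cube mult_ac)
qed

text \<open>Bounds descend one order at a time: bounded third derivatives make the second ones
  bounded, these make the first ones bounded and continuous, and these in turn make \<open>l\<close>
  continuous.\<close>

lemma partials_exist_continuous:
  fixes l :: "real^'r \<Rightarrow> real"
  assumes ex: "partials_exist 3 l (cball p \<alpha>)"
    and third: "\<And>z i j k. z \<in> cball p \<alpha> \<Longrightarrow>
      \<bar>pd [axis i 1, axis j 1, axis k 1] l z\<bar> \<le> \<kappa>"
  shows "continuous_on (ball p \<alpha>) l" and "continuous_on (ball p \<alpha>) (pd [axis i 1] l)"
proof -
  have d: "((\<lambda>t. pd vs l (z + t *\<^sub>R u)) has_real_derivative pd (u # vs) l z) (at 0)"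
    if "z \<in> cball p \<alpha>" "u \<in> Basis" "set vs \<subseteq> range (\<lambda>i. axis i 1)" "length vs \<le> 2" for z u vs
  proof -
    have "set (u # vs) \<subseteq> Basis" "length (u # vs) \<le> 3"
      using that by (auto simp: Basis_cart)
    then show ?thesis
      using ex that(1) unfolding partials_exist_def by (intro pd_Cons_has_real_derivative) blast
  qed
  have "\<exists>M. \<forall>z\<in>cball p \<alpha>. \<bar>pd [axis i 1, axis j 1] l z\<bar> \<le> M" for i j
    by (rule bounded_bounded_partials[OF d, where e = \<kappa>]) (auto simp: Basis_cart intro!: third simp del: pd.simps)
  then obtain M2 where M2: "\<And>i j z. z \<in> cball p \<alpha> \<Longrightarrow> \<bar>pd [axis i 1, axis j 1] l z\<bar> \<le> M2 i j"
    by metis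
  \<comment> \<open>A maximum over the finitely many directions provides the single constant that
    \<open>bounded_partials\<close> requires.\<close>
  have M2': "\<bar>pd [u, axis j 1] l z\<bar> \<le> Max (range (\<lambda>i. M2 i j))"
    if z: "z \<in> cball p \<alpha>" and u: "u \<in> Basis" for z u j
  proof -
    obtain i where i: "u = axis i 1" using u by (auto simp: Basis_cart)
    have "M2 i j \<le> Max (range (\<lambda>i. M2 i j))" by simp
    with M2[OF z, of i j] show ?thesis unfolding i by linarith
  qed
  show "continuous_on (ball p \<alpha>) (pd [axis i 1] l)"
    by (rule continuous_on_bounded_partials[OF d M2']) auto
  have "\<exists>M. \<forall>z\<in>cball p \<alpha>. \<bar>pd [axis j 1] l z\<bar> \<le> M" for j
    by (rule bounded_bounded_partials[OF d M2']) auto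
  then obtain M1 where M1: "\<And>j z. z \<in> cball p \<alpha> \<Longrightarrow> \<bar>pd [axis j 1] l z\<bar> \<le> M1 j"
    by metis
  have M1': "\<bar>pd [u] l z\<bar> \<le> Max (range M1)"
    if z: "z \<in> cball p \<alpha>" and u: "u \<in> Basis" for z u
  proof -
    obtain i where i: "u = axis i 1" using u by (auto simp: Basis_cart)
    have "M1 i \<le> Max (range M1)" by simp
    with M1[OF z, of i] show ?thesis unfolding i by linarith
  qed
  have "continuous_on (ball p \<alpha>) (pd [] l)"
    by (rule continuous_on_bounded_partials[OF d M1']) auto
  then show "continuous_on (ball p \<alpha>) l" by simp
qed


subsection \<open>The constraints near the true parameter\<close>

lemma Basis_prod_cart:
  "(Basis :: ((real^'r) \<times> (real^'q)) set) = range (\<lambda>i. (axis i 1, 0)) \<union> range (\<lambda>i. (0, axis i 1))"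
  by (auto simp: Basis_prod_def Basis_cart)

lemma uniformly_close_near_center:
  fixes F :: "'i \<Rightarrow> 'a::metric_space \<Rightarrow> real"
  assumes "finite I" "0 < \<alpha>" "0 < e"
    and cont: "\<And>i. i \<in> I \<Longrightarrow> continuous_on (cball c \<alpha>) (F i)"
  shows "\<exists>\<rho>>0. \<rho> \<le> \<alpha> \<and> (\<forall>z\<in>cball c \<rho>. \<forall>i\<in>I. \<bar>F i z - F i c\<bar> \<le> e)"
proof -
  have "\<forall>\<^sub>F z in at c within cball c \<alpha>. \<bar>F i z - F i c\<bar> \<le> e" if "i \<in> I" for i
  proof -
    have "(F i \<longlongrightarrow> F i c) (at c within cball c \<alpha>)"
      using cont[OF that] \<open>0 < \<alpha>\<close> by (simp add: continuous_on_def)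
    from tendstoD[OF this \<open>0 < e\<close>] show ?thesis
      by (rule eventually_mono) (simp add: dist_real_def)
  qed
  then have "\<forall>\<^sub>F z in at c within cball c \<alpha>. \<forall>i\<in>I. \<bar>F i z - F i c\<bar> \<le> e"
    using \<open>finite I\<close> by (simp add: eventually_ball_finite_distrib)
  then obtain d where d: "0 < d"
    and close: "\<And>z. z \<in> cball c \<alpha> \<Longrightarrow> z \<noteq> c \<Longrightarrow> dist z c < d \<Longrightarrow> \<forall>i\<in>I. \<bar>F i z - F i c\<bar> \<le> e"
    unfolding eventually_at by blast
  show ?thesis
  proof (intro exI conjI ballI)
    \<comment> \<open>Halving \<open>d\<close> makes membership in the closed ball imply
      \<open>dist z c < d\<close>. The case \<open>z = c\<close> is separate because the filter
      \<open>at c\<close> omits the centre.\<close>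
    fix z i assume z: "z \<in> cball c (min \<alpha> (d / 2))" and i: "i \<in> I"
    then have "z \<in> cball c \<alpha>" "dist z c < d" using d by (auto simp: dist_commute)
    then show "\<bar>F i z - F i c\<bar> \<le> e"
      using close[of z] i \<open>0 < e\<close> by (cases "z = c") auto
  qed (use \<open>0 < \<alpha>\<close> d in auto)
qed

context
  fixes h :: "(real^'r) \<times> (real^'q) \<Rightarrow> real^'t" and \<omega> :: "(real^'r) \<times> (real^'q)" and \<alpha> \<kappa> :: real
  assumes h: "constraint_conditions h \<omega> \<alpha> \<kappa>" and \<alpha>: "0 < \<alpha>"
begin

lemma constraint_deriv:
  assumes "w \<in> cball \<omega> \<alpha>" "u \<in> Basis"
  shows "((\<lambda>t. h (w + t *\<^sub>R u) $ k) has_real_derivative pd [u] (\<lambda>w. h w $ k) w) (at 0)"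
  using h assms pd_Cons_has_real_derivative[of u "[]" "\<lambda>w. h w $ k" w]
  unfolding constraint_conditions_def by (simp del: pd_exists.simps add: pd.simps(1))

lemma constraint_deriv_continuous:
  "u \<in> Basis \<Longrightarrow> continuous_on (cball \<omega> \<alpha>) (pd [u] (\<lambda>w. h w $ k))"
  using h unfolding constraint_conditions_def by blast

text \<open>Continuous first partial derivatives are bounded on the compact ball, so
  \<open>bounded_partials\<close> applies to each component.\<close>

lemma constraint_continuous: "continuous_on (ball \<omega> \<alpha>) h"
proof -
  have "continuous_on (ball \<omega> \<alpha>) (\<lambda>w. h w $ k)" for k
  proof -
    have "\<exists>M. \<forall>w\<in>cball \<omega> \<alpha>. \<bar>pd [u] (\<lambda>w. h w $ k) w\<bar> \<le> M" if "u \<in> Basis" for u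
    proof -
      have "compact (pd [u] (\<lambda>w. h w $ k) ` cball \<omega> \<alpha>)"
        by (intro compact_continuous_image constraint_deriv_continuous that compact_cball)
      then show ?thesis
        by (auto simp: bounded_real simp del: pd.simps dest!: compact_imp_bounded)
    qed
    then obtain M where M: "\<And>u w. u \<in> Basis \<Longrightarrow> w \<in> cball \<omega> \<alpha> \<Longrightarrow> \<bar>pd [u] (\<lambda>w. h w $ k) w\<bar> \<le> M u"
      by metis
    have "M u \<le> Max (M ` Basis)" if "u \<in> Basis" for u
      using that by simp
    then have "\<bar>pd [u] (\<lambda>w. h w $ k) w\<bar> \<le> Max (M ` Basis)" if "u \<in> Basis" "w \<in> cball \<omega> \<alpha>" for u w
      using M[OF that] that(1) order_trans by blast
    then show ?thesis
      by (intro continuous_on_bounded_partials[OF constraint_deriv])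
  qed
  then have "continuous_on (ball \<omega> \<alpha>) (\<lambda>w. \<chi> k. h w $ k)"
    by (rule continuous_on_vec_lambda)
  then show ?thesis by simp
qed

lemma constraint_deriv_close:
  assumes "0 < e"
  shows "\<exists>\<rho>>0. \<rho> \<le> \<alpha> \<and> (\<forall>w\<in>cball \<omega> \<rho>. \<forall>u\<in>Basis. \<forall>k.
    \<bar>pd [u] (\<lambda>w. h w $ k) w - pd [u] (\<lambda>w. h w $ k) \<omega>\<bar> \<le> e)"
proof -
  have "\<exists>\<rho>>0. \<rho> \<le> \<alpha> \<and> (\<forall>w\<in>cball \<omega> \<rho>. \<forall>i\<in>Basis \<times> UNIV.
      \<bar>pd [fst i] (\<lambda>w. h w $ snd i) w - pd [fst i] (\<lambda>w. h w $ snd i) \<omega>\<bar> \<le> e)"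
    by (rule uniformly_close_near_center)
      (use \<alpha> assms constraint_deriv_continuous in \<open>auto simp del: pd.simps\<close>)
  then show ?thesis by force
qed

text \<open>Full column rank makes \<open>jacJ h \<omega>\<close> injective, hence bounded below;
  near \<open>\<omega>\<close> the entries change so little that half of the bound survives. This
  later bounds the multipliers.\<close>

lemma jacJ_bounded_below:
  "\<exists>m>0. \<exists>\<rho>>0. \<rho> \<le> \<alpha> \<and> (\<forall>w\<in>cball \<omega> \<rho>. \<forall>l. m * norm l \<le> norm (jacJ h w *v l))"
proof -
  have "inj ((*v) (jacJ h \<omega>))"
    using h unfolding constraint_conditions_def by (simp add: full_rank_injective)
  then obtain m where m: "0 < m" "\<And>l. m * norm l \<le> norm (jacJ h \<omega> *v l)"
    using linear_inj_bounded_below_pos matrix_vector_mul_linear by blast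
  \<comment> \<open>\<open>?N\<close> is the number of entries of the matrix: entrywise errors of at
    most \<open>m / (2 * ?N)\<close> give an operator norm of at most \<open>m / 2\<close>.\<close>
  let ?N = "real CARD('r) * real CARD('t)"
  have N: "0 < ?N" by simp
  have "0 < m / (2 * ?N)" using m(1) N by simp
  from constraint_deriv_close[OF this] obtain \<rho> where \<rho>: "0 < \<rho>" "\<rho> \<le> \<alpha>"
    and close: "\<forall>w\<in>cball \<omega> \<rho>. \<forall>u\<in>Basis. \<forall>k.
      \<bar>pd [u] (\<lambda>w. h w $ k) w - pd [u] (\<lambda>w. h w $ k) \<omega>\<bar> \<le> m / (2 * ?N)"
    by (elim exE conjE)
  have "m / 2 * norm l \<le> norm (jacJ h w *v l)" if w: "w \<in> cball \<omega> \<rho>" for w l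
  proof -
    have "onorm ((*v) (jacJ h w - jacJ h \<omega>)) \<le> ?N * (m / (2 * ?N))"
      by (rule onorm_le_matrix_component)
        (use bspec[OF close w] in \<open>simp add: jacJ_def Basis_prod_cart del: pd.simps\<close>)
    then have "onorm ((*v) (jacJ h w - jacJ h \<omega>)) \<le> m / 2" using N by simp
    then have "norm ((jacJ h w - jacJ h \<omega>) *v l) \<le> m / 2 * norm l"
      using onorm[OF matrix_vector_mul_bounded_linear, of "jacJ h w - jacJ h \<omega>" l]
      by (meson mult_right_mono norm_ge_zero order_trans)
    moreover have "jacJ h \<omega> *v l = jacJ h w *v l - (jacJ h w - jacJ h \<omega>) *v l"
      by (simp add: matrix_vector_mult_diff_rdistrib)
    then have "norm (jacJ h \<omega> *v l) \<le> norm (jacJ h w *v l) + norm ((jacJ h w - jacJ h \<omega>) *v l)"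
      by (metis norm_triangle_ineq4)
    ultimately show ?thesis using m(2)[of l] by linarith
  qed
  with m(1) \<rho> show ?thesis by (metis half_gt_zero)
qed

text \<open>Differentiability at the centre follows from continuity of the partial derivatives, by
  the mean value estimate for each component. The transposes appear because \<open>jacJ\<close> and
  \<open>jacK\<close> store gradients as columns.\<close>

lemma constraint_linear_approximation:
  assumes "0 < e"
  shows "\<exists>\<rho>>0. \<rho> \<le> \<alpha> \<and> (\<forall>w\<in>cball \<omega> \<rho>.
    norm (h w - h \<omega> - (transpose (jacJ h \<omega>) *v (fst w - fst \<omega>) + transpose (jacK h \<omega>) *v (snd w - snd \<omega>)))
      \<le> e * norm (w - \<omega>))"
proof -
  \<comment> \<open>The factor \<open>DIM\<close> offsets the one in the mean value estimate, and
    \<open>CARD('t)\<close> the passage from components to the norm.\<close>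
  let ?N = "real CARD('t) * DIM((real^'r) \<times> (real^'q))"
  have N: "0 < ?N" by (simp only: zero_less_mult_iff of_nat_0_less_iff DIM_positive zero_less_card_finite) simp
  then have "0 < e / ?N" using assms by (rule divide_pos_pos[rotated])
  from constraint_deriv_close[OF this] obtain \<rho> where \<rho>: "0 < \<rho>" "\<rho> \<le> \<alpha>"
    and close: "\<forall>w\<in>cball \<omega> \<rho>. \<forall>u\<in>Basis. \<forall>k.
      \<bar>pd [u] (\<lambda>w. h w $ k) w - pd [u] (\<lambda>w. h w $ k) \<omega>\<bar> \<le> e / ?N"
    by (elim exE conjE)
  define E where "E w = h w - h \<omega> -
    (transpose (jacJ h \<omega>) *v (fst w - fst \<omega>) + transpose (jacK h \<omega>) *v (snd w - snd \<omega>))" for w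
  have "norm (E w) \<le> e * norm (w - \<omega>)" if w: "w \<in> cball \<omega> \<rho>" for w
  proof -
    have comp: "\<bar>E w $ k\<bar> \<le> e / ?N * DIM((real^'r) \<times> (real^'q)) * norm (w - \<omega>)" for k
    proof -
      \<comment> \<open>\<open>L\<close> is the gradient of component \<open>k\<close> of
        \<open>h\<close> at \<open>\<omega>\<close>.\<close>
      define L where "L = (column k (jacJ h \<omega>), column k (jacK h \<omega>))"
      have "\<bar>h w $ k - h \<omega> $ k - L \<bullet> (w - \<omega>)\<bar>
          \<le> e / ?N * DIM((real^'r) \<times> (real^'q)) * norm (w - \<omega>)"
      proof (rule partials_mean_value[OF _ _ w])
        fix z and u :: "(real^'r) \<times> (real^'q)" assume z: "z \<in> cball \<omega> \<rho>" and u: "u \<in> Basis"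
        show "((\<lambda>t. h (z + t *\<^sub>R u) $ k) has_real_derivative pd [u] (\<lambda>w. h w $ k) z) (at 0)"
          using z \<rho> u by (intro constraint_deriv) auto
        have "L \<bullet> u = pd [u] (\<lambda>w. h w $ k) \<omega>"
          using u by (auto simp: L_def Basis_prod_cart inner_axis column_def jacJ_def jacK_def
              simp del: pd.simps)
        then show "\<bar>pd [u] (\<lambda>w. h w $ k) z - L \<bullet> u\<bar> \<le> e / ?N"
          using bspec[OF bspec[OF close z] u] by (simp del: pd.simps)
      qed
      moreover have "L \<bullet> (w - \<omega>) = (transpose (jacJ h \<omega>) *v (fst w - fst \<omega>)) $ k
          + (transpose (jacK h \<omega>) *v (snd w - snd \<omega>)) $ k"
        by (simp add: L_def inner_prod_def matrix_vector_mul_component transpose_def column_def)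
      ultimately show ?thesis by (simp add: E_def)
    qed
    have "norm (E w) \<le> (\<Sum>k\<in>UNIV. \<bar>E w $ k\<bar>)" by (rule norm_le_l1_cart)
    also have "\<dots> \<le> real CARD('t) * (e / ?N * DIM((real^'r) \<times> (real^'q)) * norm (w - \<omega>))"
      by (rule sum_bounded_above) (rule comp)
    also have "\<dots> = ?N * (e / ?N) * norm (w - \<omega>)" by simp
    also have "\<dots> = e * norm (w - \<omega>)"
      using nonzero_mult_div_cancel_left[OF less_imp_neq[OF N, symmetric]] by (simp only: times_divide_eq_right)
    finally show ?thesis .
  qed
  with \<rho> show ?thesis unfolding E_def by blast
qed

text \<open>Since \<open>K\<close> has full rank, \<open>\<psi>\<close> is controlled by \<open>\<phi>\<close> on the constraint set.\<close>

lemma constraint_first_component: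
  assumes h0: "h \<omega> = 0"
  shows "\<exists>c>0. \<exists>\<rho>>0. \<rho> \<le> \<alpha> \<and>
    (\<forall>w\<in>cball \<omega> \<rho>. h w = 0 \<longrightarrow> c * norm (w - \<omega>) \<le> norm (fst w - fst \<omega>))"
proof -
  let ?J = "transpose (jacJ h \<omega>)" and ?K = "transpose (jacK h \<omega>)"
  \<comment> \<open>\<open>jacK h \<omega>\<close> has full row rank, so its transpose is
    injective.\<close>
  have "rank ?K = CARD('q)"
    using h unfolding constraint_conditions_def by (simp add: rank_transpose)
  then have "inj ((*v) ?K)" by (simp only: full_rank_injective)
  then obtain m where m: "0 < m" "\<And>b. m * norm b \<le> norm (?K *v b)"
    using linear_inj_bounded_below_pos matrix_vector_mul_linear by blast
  obtain C where C: "0 < C" "\<And>a. norm (?J *v a) \<le> C * norm a"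
    using linear_bounded_pos matrix_vector_mul_linear by blast
  obtain \<rho> where \<rho>: "0 < \<rho>" "\<rho> \<le> \<alpha>" and approx: "\<And>w. w \<in> cball \<omega> \<rho> \<Longrightarrow>
      norm (h w - h \<omega> - (?J *v (fst w - fst \<omega>) + ?K *v (snd w - snd \<omega>))) \<le> m / 2 * norm (w - \<omega>)"
    using constraint_linear_approximation[of "m / 2"] m(1) by (meson half_gt_zero)
  \<comment> \<open>With \<open>a\<close>, \<open>b\<close> the two components of
    \<open>w - \<omega>\<close>, the approximation gives
    \<open>m * norm b \<le> m / 2 * norm (w - \<omega>) + C * norm a\<close>. Adding
    \<open>m * norm a\<close> and absorbing half of \<open>m * norm (w - \<omega>)\<close> yields
    the constant.\<close>
  have "m / (2 * (C + m)) * norm (w - \<omega>) \<le> norm (fst w - fst \<omega>)" if w: "w \<in> cball \<omega> \<rho>" "h w = 0" for w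
  proof -
    let ?a = "fst w - fst \<omega>" and ?b = "snd w - snd \<omega>"
    have "norm (?J *v ?a + ?K *v ?b) \<le> m / 2 * norm (w - \<omega>)"
      using approx[OF w(1)] w(2) h0 by (metis diff_self diff_0 norm_minus_cancel)
    moreover have "norm (?K *v ?b) \<le> norm (?J *v ?a + ?K *v ?b) + norm (?J *v ?a)"
      by (metis add_diff_cancel_left' norm_triangle_ineq4)
    ultimately have "m * norm ?b \<le> m / 2 * norm (w - \<omega>) + C * norm ?a"
      using m(2)[of ?b] C(2)[of ?a] by linarith
    moreover have nw: "norm (w - \<omega>) \<le> norm ?a + norm ?b"
      using norm_Pair_le[of ?a ?b] by (simp add: minus_prod_def)
    moreover have "m * norm (w - \<omega>) \<le> m * (norm ?a + norm ?b)"
      using nw m(1) by (intro mult_left_mono) auto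
    ultimately have "m * norm (w - \<omega>) \<le> 2 * (C + m) * norm ?a"
      by (simp add: algebra_simps)
    then show ?thesis
      using m(1) C(1) by (simp add: field_simps)
  qed
  moreover have "0 < m / (2 * (C + m))" using m(1) C(1) by simp
  ultimately show ?thesis using \<rho> by blast
qed

end


subsection \<open>Existence of a constrained critical point\<close>

text \<open>This is \<open>penalty_lagrange\<close> for \<open>- l / n\<close> as a function of the
  pair. Because \<open>l\<close> sees only the first component, directions in the second one carry
  no score term and give the equation for \<open>jacK\<close>; the other directions give the score
  equation.\<close>

lemma constrained_critical_point:
  fixes l :: "real^'r \<Rightarrow> real" and h :: "(real^'r) \<times> (real^'q) \<Rightarrow> real^'t"
  assumes n: "0 < n" and \<delta>: "0 < \<delta>" "\<delta> < \<alpha>"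
    and h: "constraint_conditions h \<omega> \<alpha> \<kappa>" and h0: "h \<omega> = 0"
    and ex: "partials_exist 3 l (cball (fst \<omega>) \<alpha>)"
    and third: "\<And>z i j k. z \<in> cball (fst \<omega>) \<alpha> \<Longrightarrow>
      \<bar>pd [axis i 1, axis j 1, axis k 1] l z\<bar> \<le> \<kappa>'"
    and m: "0 < m" "\<And>w v. w \<in> cball \<omega> \<delta> \<Longrightarrow> m * norm v \<le> norm (jacJ h w *v v)"
    and boundary: "\<And>w. dist \<omega> w = \<delta> \<Longrightarrow> h w = 0 \<Longrightarrow> l (fst w) < l (fst \<omega>)"
  shows "\<exists>\<phi> \<psi> lam. (1 / n) *\<^sub>R (\<chi> i. pd [axis i 1] l \<phi>) + jacJ h (\<phi>, \<psi>) *v lam = 0 \<and>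
    jacK h (\<phi>, \<psi>) *v lam = 0 \<and> h (\<phi>, \<psi>) = 0 \<and> (\<phi>, \<psi>) \<in> cball \<omega> \<delta>"
proof -
  define G where "G w = - l (fst w) / n" for w :: "(real^'r) \<times> (real^'q)"
  define G' where "G' u w = - pd [fst u] l (fst w) / n" for u w :: "(real^'r) \<times> (real^'q)"
  define H' where "H' u k = pd [u] (\<lambda>w. h w $ k)" for u k
  have \<alpha>: "0 < \<alpha>" using \<delta> by linarith
  have sub: "cball \<omega> \<delta> \<subseteq> ball \<omega> \<alpha>" using \<delta> by auto
  then have sub': "cball \<omega> \<delta> \<subseteq> cball \<omega> \<alpha>" using ball_subset_cball by blast
  have fst_in: "fst w \<in> ball (fst \<omega>) \<alpha>" if "w \<in> cball \<omega> \<delta>" for w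
    using that dist_fst_le[of \<omega> w] \<delta> by simp
  \<comment> \<open>For basis vectors of the second factor \<open>fst u\<close> is \<open>0\<close>,
    and the derivative is that of a constant.\<close>
  have pd0: "pd [0] l z = 0" for z by simp
  have contl: "continuous_on (ball (fst \<omega>) \<alpha>) l" "continuous_on (ball (fst \<omega>) \<alpha>) (pd [axis i 1] l)" for i
    using partials_exist_continuous[OF ex third] by blast+
  have cont_fst: "continuous_on (cball \<omega> \<delta>) (\<lambda>w. F (fst w))"
    if "continuous_on (ball (fst \<omega>) \<alpha>) F" for F :: "real^'r \<Rightarrow> real"
    by (rule continuous_on_compose2[OF that continuous_on_fst[OF continuous_on_id]])
      (use fst_in in blast)
  have "\<exists>w v. w \<in> cball \<omega> \<delta> \<and> h w = 0 \<and>
      (\<forall>u\<in>Basis. G' u w + (\<Sum>k\<in>UNIV. v $ k * H' u k w) = 0)"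
  proof (rule penalty_lagrange[where G = G and H = h and c = \<omega> and \<delta> = \<delta> and m = m])
    fix w u :: "(real^'r) \<times> (real^'q)" assume w: "w \<in> ball \<omega> \<delta>" and u: "u \<in> Basis"
    then have wc: "w \<in> cball \<omega> \<delta>" by simp
    have "((\<lambda>t. l (fst w + t *\<^sub>R fst u)) has_real_derivative pd [fst u] l (fst w)) (at 0)"
    proof (cases "fst u = 0")
      case False
      then obtain i where i: "fst u = axis i 1" using u by (auto simp: Basis_prod_cart)
      have "pd_exists [axis i 1] l (fst w)"
        using ex fst_in[OF wc] unfolding partials_exist_def by (simp add: less_imp_le del: pd_exists.simps)
      from pd_Cons_has_real_derivative[OF this] show ?thesis by (simp add: i)
    qed simp
    then show "((\<lambda>t. G (w + t *\<^sub>R u)) has_real_derivative G' u w) (at 0)"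
      unfolding G_def G'_def fst_add fst_scaleR using n
      by (auto intro!: derivative_eq_intros simp del: pd.simps)
    show "((\<lambda>t. h (w + t *\<^sub>R u) $ k) has_real_derivative H' u k w) (at 0)" for k
      unfolding H'_def using wc sub' u by (intro constraint_deriv[OF h \<alpha>]) auto
  next
    show "0 < \<delta>" "h \<omega> = 0" "0 < m" by fact+
    show "continuous_on (cball \<omega> \<delta>) G"
      unfolding G_def using n by (intro continuous_intros cont_fst contl) auto
    show "continuous_on (cball \<omega> \<delta>) h"
      by (rule continuous_on_subset[OF constraint_continuous[OF h \<alpha>] sub])
  next
    fix u :: "(real^'r) \<times> (real^'q)" assume u: "u \<in> Basis"
    show "continuous_on (cball \<omega> \<delta>) (G' u)"
    proof (cases "fst u = 0")
      case True
      then have "G' u = (\<lambda>_. 0)" unfolding G'_def True pd0 by simp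
      then show ?thesis by simp
    next
      case False
      then obtain i where "fst u = axis i 1" using u by (auto simp: Basis_prod_cart)
      then show ?thesis
        unfolding G'_def using n by (simp only:) (intro continuous_intros cont_fst contl, auto)
    qed
    show "continuous_on (cball \<omega> \<delta>) (H' u k)" for k
      unfolding H'_def
      by (rule continuous_on_subset[OF constraint_deriv_continuous[OF h \<alpha> u] sub'])
  next
    fix w :: "(real^'r) \<times> (real^'q)" assume "dist \<omega> w = \<delta>" "h w = 0"
    from boundary[OF this] show "G \<omega> < G w"
      using n by (simp add: G_def divide_strict_right_mono)
  next
    \<comment> \<open>The basis vectors of the first factor already produce all coordinates of
      \<open>jacJ h w *v v\<close>; the remaining terms only enlarge the sum.\<close>
    fix w and v :: "real^'t" assume w: "w \<in> cball \<omega> \<delta>"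
    have "m * norm v \<le> (\<Sum>i\<in>UNIV. \<bar>(jacJ h w *v v) $ i\<bar>)"
      using m(2)[OF w] norm_le_l1_cart by (rule order_trans)
    also have "\<dots> = (\<Sum>i\<in>UNIV. \<bar>\<Sum>k\<in>UNIV. v $ k * H' (axis i 1, 0) k w\<bar>)"
      by (simp add: jacJ_def H'_def matrix_vector_mult_def mult.commute del: pd.simps)
    also have "\<dots> = (\<Sum>u\<in>range (\<lambda>i. (axis i 1, 0)). \<bar>\<Sum>k\<in>UNIV. v $ k * H' u k w\<bar>)"
      by (subst sum.reindex) (auto simp: inj_on_def axis_eq_axis)
    also have "\<dots> \<le> (\<Sum>u\<in>Basis. \<bar>\<Sum>k\<in>UNIV. v $ k * H' u k w\<bar>)"
      by (rule sum_mono2) (auto simp: Basis_prod_cart)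
    finally show "m * norm v \<le> (\<Sum>u\<in>Basis. \<bar>\<Sum>k\<in>UNIV. v $ k * H' u k w\<bar>)" .
  qed
  then obtain w v where w: "w \<in> cball \<omega> \<delta>" "h w = 0"
    and eq: "\<And>u. u \<in> Basis \<Longrightarrow> G' u w + (\<Sum>k\<in>UNIV. v $ k * H' u k w) = 0"
    by blast
  \<comment> \<open>\<open>G\<close> carries a minus sign, so the multiplier of the system is
    \<open>- v\<close>.\<close>
  have "(1 / n) *\<^sub>R (\<chi> i. pd [axis i 1] l (fst w)) + jacJ h w *v (- v) = 0"
  proof -
    have "1 / n * pd [axis i 1] l (fst w) + (\<Sum>k\<in>UNIV. pd [(axis i 1, 0)] (\<lambda>w. h w $ k) w * - v $ k) = 0" for i
      using eq[of "(axis i 1, 0)"]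
      by (simp add: G'_def H'_def Basis_prod_cart sum_negf mult.commute del: pd.simps)
    then show ?thesis
      by (simp add: vec_eq_iff jacJ_def matrix_vector_mult_def del: pd.simps)
  qed
  moreover have "jacK h w *v (- v) = 0"
  proof -
    have "(\<Sum>k\<in>UNIV. pd [(0, axis i 1)] (\<lambda>w. h w $ k) w * - v $ k) = 0" for i
    proof -
      have "G' (0, axis i 1) w = 0" unfolding G'_def fst_conv pd0 by simp
      then show ?thesis
        using eq[of "(0, axis i 1)"]
        by (simp add: H'_def Basis_prod_cart sum_negf mult.commute del: pd.simps)
    qed
    then show ?thesis
      by (simp add: vec_eq_iff jacK_def matrix_vector_mult_def del: pd.simps)
  qed
  ultimately show ?thesis
    using w by (intro exI[of _ "fst w"] exI[of _ "snd w"] exI[of _ "- v"]) (simp del: pd.simps)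
qed

text \<open>Turns the parameter set of \<open>good_sample_set\<close> into a ball; a preimage of a
  point is found by keeping the second component of the centre.\<close>

lemma fst_cball_prod:
  "fst ` cball (c :: 'a::metric_space \<times> 'b::metric_space) \<rho> = cball (fst c) \<rho>"
proof
  show "fst ` cball c \<rho> \<subseteq> cball (fst c) \<rho>"
  proof
    fix x assume "x \<in> fst ` cball c \<rho>"
    then obtain w where w: "w \<in> cball c \<rho>" and x: "x = fst w" by blast
    then show "x \<in> cball (fst c) \<rho>" using dist_fst_le[of c w] by simp
  qed
  show "cball (fst c) \<rho> \<subseteq> fst ` cball c \<rho>"
  proof
    fix x assume "x \<in> cball (fst c) \<rho>"
    then have "(x, snd c) \<in> cball c \<rho>" by (simp add: dist_prod_def)
    then show "x \<in> fst ` cball c \<rho>" by force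
  qed
qed

theorem theorem1:
  fixes f :: "real \<Rightarrow> real^'r \<Rightarrow> real"
    and h :: "(real^'r) \<times> (real^'q) \<Rightarrow> real^'t"
    and \<omega>s :: "(real^'r) \<times> (real^'q)"
    and \<alpha> \<kappa>1 \<kappa>2 :: real
  assumes "CARD('q) \<le> CARD('t)" and "CARD('t) \<le> CARD('r)"
    and "0 < \<alpha>"
    and "density_conditions f \<omega>s \<alpha> \<kappa>1"
    and "constraint_conditions h \<omega>s \<alpha> \<kappa>2"
    and "h \<omega>s = 0"
  shows "\<exists>\<delta>0. 0 < \<delta>0 \<and> \<delta>0 \<le> \<alpha> \<and>
    (\<forall>\<delta> \<epsilon> N n X x.
       0 < \<delta> \<and> \<delta> < \<delta>0 \<and> 0 < \<epsilon> \<and> \<epsilon> < 1 \<and>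
       sample_threshold f \<omega>s \<alpha> \<kappa>1 \<delta> \<epsilon> N \<and> N \<le> n \<and>
       good_sample_set f \<omega>s \<alpha> \<kappa>1 \<delta> \<epsilon> n X \<and> x \<in> X \<longrightarrow>
       (\<exists>\<phi> \<psi> lam.
          (1 / real n) *\<^sub>R score f n x \<phi> + jacJ h (\<phi>, \<psi>) *v lam = 0 \<and>
          jacK h (\<phi>, \<psi>) *v lam = 0 \<and>
          h (\<phi>, \<psi>) = 0 \<and>
          (\<phi>, \<psi>) \<in> cball \<omega>s \<delta>))"
proof -
  note h = assms(5)
  let ?p = "fst \<omega>s"
  define B where "B = fisher f ?p"
  have pos: "pos_def B"
    using assms(4) unfolding density_conditions_def B_def Let_def by blast
  then have sym: "transpose B = B" by (simp add: pos_def_def)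
  obtain b where b: "0 < b" "\<And>v. b * (norm v)\<^sup>2 \<le> v \<bullet> (B *v v)"
    using pos_def_lower_bound[OF pos] by blast
  obtain m \<rho>1 where m: "0 < m" "\<And>w v. w \<in> cball \<omega>s \<rho>1 \<Longrightarrow> m * norm v \<le> norm (jacJ h w *v v)"
    and \<rho>1: "0 < \<rho>1" "\<rho>1 \<le> \<alpha>"
    using jacJ_bounded_below[OF h assms(3)] by blast
  obtain c \<rho>2 where c: "0 < c" "\<And>w. w \<in> cball \<omega>s \<rho>2 \<Longrightarrow> h w = 0 \<Longrightarrow>
      c * norm (w - \<omega>s) \<le> norm (fst w - ?p)"
    and \<rho>2: "0 < \<rho>2" "\<rho>2 \<le> \<alpha>"
    using constraint_first_component[OF h assms(3,6)] by blast
  \<comment> \<open>The absolute value secures \<open>0 \<le> \<kappa>\<close>, as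
    \<open>quadratic_approximation\<close> requires.\<close>
  define \<kappa> where "\<kappa> = 2 * \<bar>\<kappa>1\<bar>"
  define R where "R = real CARD('r)"
  \<comment> \<open>This is the coefficient of \<open>\<delta> ^ 3\<close> in
    \<open>quadratic_approximation\<close>, apart from the factor \<open>n\<close>.\<close>
  define C where "C = (1 + (1 + \<kappa> * R) * R) * R"
  have "0 < R" by (simp add: R_def)
  moreover have "0 \<le> \<kappa>" by (simp add: \<kappa>_def)
  ultimately have C: "0 < C" unfolding C_def by (intro mult_pos_pos add_pos_nonneg) auto
  \<comment> \<open>Within \<open>\<rho>1\<close> the matrix \<open>jacJ\<close> stays bounded
    below; within \<open>\<rho>2\<close> the first component controls the whole increment where
    \<open>h\<close> vanishes. The last bound ensures
    \<open>C * \<delta> ^ 3 < b * c\<^sup>2 * \<delta>\<^sup>2 / 2\<close>.\<close>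
  define \<delta>0 where "\<delta>0 = min (min \<rho>1 \<rho>2) (b * c\<^sup>2 / (2 * C))"
  show ?thesis
  proof (intro exI[of _ \<delta>0] conjI allI impI)
    show "0 < \<delta>0" using \<rho>1 \<rho>2 b(1) c(1) C by (simp add: \<delta>0_def)
    show "\<delta>0 \<le> \<alpha>" using \<rho>1 by (simp add: \<delta>0_def)
  next
    fix \<delta> \<epsilon> N n X x
    assume *: "0 < \<delta> \<and> \<delta> < \<delta>0 \<and> 0 < \<epsilon> \<and> \<epsilon> < 1 \<and>
       sample_threshold f \<omega>s \<alpha> \<kappa>1 \<delta> \<epsilon> N \<and> N \<le> n \<and>
       good_sample_set f \<omega>s \<alpha> \<kappa>1 \<delta> \<epsilon> n X \<and> x \<in> X"
    then have \<delta>: "0 < \<delta>" "\<delta> < \<delta>0" by blast+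
    \<comment> \<open>Positivity comes from \<open>0 < N\<close> in \<open>sample_threshold\<close>;
      it permits clearing the factor \<open>1 / n\<close> in the sample conditions.\<close>
    have n: "0 < real n" using * unfolding sample_threshold_def by simp
    define l where "l = loglik f n x"
    have good: "partials_exist 3 l (cball ?p \<alpha>)"
      "norm (score f n x ?p /\<^sub>R real n) < \<delta>\<^sup>2"
      "\<exists>m :: real^'r^'r. (\<forall>i j. \<bar>m $ i $ j\<bar> \<le> 1) \<and>
        hess f n x ?p /\<^sub>R real n = - B + \<delta> *\<^sub>R m"
      "\<forall>z\<in>cball ?p \<alpha>. \<forall>i j k.
        \<bar>1 / real n * pd [axis i 1, axis j 1, axis k 1] l z\<bar> < 2 * \<kappa>1"
      using * unfolding good_sample_set_def Let_def fst_cball_prod l_def B_def by blast+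
    have third: "\<bar>pd [axis i 1, axis j 1, axis k 1] l z\<bar> \<le> real n * \<kappa>"
      if "z \<in> cball ?p \<alpha>" for z i j k
    proof -
      have "\<bar>1 / real n * pd [axis i 1, axis j 1, axis k 1] l z\<bar> < 2 * \<kappa>1"
        using good(4) that by blast
      also have "\<dots> \<le> \<kappa>" by (simp add: \<kappa>_def)
      finally have "\<bar>1 / real n * pd [axis i 1, axis j 1, axis k 1] l z\<bar> \<le> \<kappa>"
        by (rule less_imp_le)
      then show ?thesis using n by (simp add: abs_mult field_simps del: pd.simps)
    qed
    have grad: "\<bar>pd [axis i 1] l ?p\<bar> \<le> real n * \<delta>\<^sup>2" for i
    proof -
      have "\<bar>(score f n x ?p /\<^sub>R real n) $ i\<bar> \<le> \<delta>\<^sup>2"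
        using component_le_norm_cart[of "score f n x ?p /\<^sub>R real n" i] good(2) by linarith
      then show ?thesis
        using n by (simp add: score_def l_def abs_mult field_simps del: pd.simps)
    qed
    have hess: "\<bar>pd [axis i 1, axis j 1] l ?p + real n * B $ i $ j\<bar> \<le> real n * \<delta>" for i j
    proof -
      obtain m :: "real^'r^'r" where m: "\<bar>m $ i $ j\<bar> \<le> 1"
        and eq: "hess f n x ?p /\<^sub>R real n = - B + \<delta> *\<^sub>R m"
        using good(3) by blast
      have "inverse (real n) * pd [axis i 1, axis j 1] l ?p = - B $ i $ j + \<delta> * m $ i $ j"
        using arg_cong[OF eq, of "\<lambda>A. A $ i $ j"] by (simp add: hess_def l_def del: pd.simps)
      then have "pd [axis i 1, axis j 1] l ?p + real n * B $ i $ j = real n * \<delta> * m $ i $ j"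
        using n by (simp add: field_simps del: pd.simps)
      moreover have "\<bar>real n * \<delta> * m $ i $ j\<bar> \<le> real n * \<delta> * 1"
        unfolding abs_mult using n \<delta> m by (intro mult_mono) auto
      ultimately show ?thesis by (simp del: pd.simps)
    qed
    have \<delta>\<alpha>: "\<delta> < \<alpha>" using \<delta>(2) \<rho>1(2) by (simp add: \<delta>0_def)
    have ex\<delta>: "partials_exist 3 l (cball ?p \<delta>)"
      using good(1) \<delta>\<alpha> unfolding partials_exist_def by simp
    have boundary: "l (fst w) < l ?p" if w: "dist \<omega>s w = \<delta>" and hw: "h w = 0" for w
    proof -
      let ?v = "fst w - ?p"
      have "dist ?p (fst w) \<le> \<delta>" using dist_fst_le[of \<omega>s w] w by simp
      then have "\<bar>l (fst w) - l ?p + real n / 2 * (?v \<bullet> (B *v ?v))\<bar> \<le> real n * (C * \<delta> ^ 3)"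
        unfolding C_def R_def using \<delta>\<alpha>
        by (intro quadratic_approximation[OF n \<open>0 \<le> \<kappa>\<close> ex\<delta> sym grad hess] third) auto
      \<comment> \<open>On the constrained sphere the quadratic loss is at least
        \<open>n / 2 * b * (c * \<delta>)\<^sup>2\<close>, which exceeds the cubic error by the
        choice of \<open>\<delta>0\<close>.\<close>
      moreover have "real n * (C * \<delta> ^ 3) < real n / 2 * (?v \<bullet> (B *v ?v))"
      proof -
        have "c * \<delta> \<le> norm ?v"
          using c(2)[of w] w hw \<delta>(2) by (simp add: \<delta>0_def dist_norm norm_minus_commute)
        then have "(c * \<delta>)\<^sup>2 \<le> (norm ?v)\<^sup>2"
          using c(1) \<delta>(1) by (intro power_mono) auto
        then have "b * (c * \<delta>)\<^sup>2 \<le> ?v \<bullet> (B *v ?v)"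
          using b(1) by (intro order_trans[OF _ b(2)] mult_left_mono) auto
        moreover have "2 * C * \<delta> < b * c\<^sup>2"
          using \<delta>(2) C by (simp add: \<delta>0_def field_simps)
        then have "2 * C * \<delta> * \<delta>\<^sup>2 < b * c\<^sup>2 * \<delta>\<^sup>2"
          using \<delta>(1) by (intro mult_strict_right_mono) auto
        ultimately have "2 * (C * \<delta> ^ 3) < ?v \<bullet> (B *v ?v)"
          by (simp add: power_mult_distrib power2_eq_square power3_eq_cube mult_ac)
        then show ?thesis using n by simp
      qed
      ultimately show ?thesis by linarith
    qed
    have "\<exists>\<phi> \<psi> lam. (1 / real n) *\<^sub>R (\<chi> i. pd [axis i 1] l \<phi>) + jacJ h (\<phi>, \<psi>) *v lam = 0 \<and>
        jacK h (\<phi>, \<psi>) *v lam = 0 \<and> h (\<phi>, \<psi>) = 0 \<and> (\<phi>, \<psi>) \<in> cball \<omega>s \<delta>"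
    proof (rule constrained_critical_point[OF n \<delta>(1) \<delta>\<alpha> h assms(6) good(1) third m(1) _ boundary])
      fix w v assume "w \<in> cball \<omega>s \<delta>"
      then show "m * norm v \<le> norm (jacJ h w *v v)"
        using \<delta>(2) by (intro m(2)) (simp add: \<delta>0_def)
    qed
    then show "\<exists>\<phi> \<psi> lam.
          (1 / real n) *\<^sub>R score f n x \<phi> + jacJ h (\<phi>, \<psi>) *v lam = 0 \<and>
          jacK h (\<phi>, \<psi>) *v lam = 0 \<and> h (\<phi>, \<psi>) = 0 \<and> (\<phi>, \<psi>) \<in> cball \<omega>s \<delta>"
      unfolding score_def l_def .
  qed
qed

end
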